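(* Let $q$ be a prime power (of any characteristic) and let $O^+(2n,q)$ be the orthogonal group of a nondegenerate quadratic form of plus type (maximal Witt index) on $\mathbb{F}_q^{2n}$, acting naturally on $\mathbb{F}_q^{2n}$. Let $g$ be chosen uniformly at random from $O^+(2n,q)$ and let $Z_n$ be the number of vectors $v\in\mathbb{F}_q^{2n}$ with $gv=v$. Then for every natural number $j$ and every $n\ge j$, $$E[Z_n^j]=\prod_{i=1}^{j}\left(q^{i}+1\right).$$ *)

theory Defs
  imports "HOL-Probability.Probability"
begin

definition polar :: "('v::ab_group_add \<Rightarrow> 'a::field) \<Rightarrow> 'v \<Rightarrow> 'v \<Rightarrow> 'a" where
  "polar Q u v = Q (u + v) - Q u - Q v"

definition quadratic_form ::
  "('a::field \<Rightarrow> 'v::ab_group_add \<Rightarrow> 'v) \<Rightarrow> ('v \<Rightarrow> 'a) \<Rightarrow> bool" where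
  "quadratic_form sc Q \<longleftrightarrow>
     (\<forall>a v. Q (sc a v) = a ^ 2 * Q v) \<and>
     (\<forall>u. Vector_Spaces.linear sc (*) (\<lambda>v. polar Q u v)) \<and>
     (\<forall>v. Vector_Spaces.linear sc (*) (\<lambda>u. polar Q u v))"

(* Nondegeneracy refers to the polar form, also in characteristic 2; this is the usual
   convention in even dimension. *)
definition nondegenerate :: "('v::ab_group_add \<Rightarrow> 'a::field) \<Rightarrow> bool" where
  "nondegenerate Q \<longleftrightarrow> (\<forall>u. (\<forall>v. polar Q u v = 0) \<longrightarrow> u = 0)"

definition totally_singular ::
  "('a::field \<Rightarrow> 'v::ab_group_add \<Rightarrow> 'v) \<Rightarrow> ('v \<Rightarrow> 'a) \<Rightarrow> 'v set \<Rightarrow> bool" where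
  "totally_singular sc Q W \<longleftrightarrow> module.subspace sc W \<and> (\<forall>w\<in>W. Q w = 0)"

definition witt_index ::
  "('a::field \<Rightarrow> 'v::{ab_group_add,finite} \<Rightarrow> 'v) \<Rightarrow> ('v \<Rightarrow> 'a) \<Rightarrow> nat" where
  "witt_index sc Q = Max {vector_space.dim sc W | W. totally_singular sc Q W}"

(* The Witt index of a nondegenerate form is at most half the dimension of the space. *)
definition plus_type ::
  "('a::field \<Rightarrow> 'v::{ab_group_add,finite} \<Rightarrow> 'v) \<Rightarrow> ('v \<Rightarrow> 'a) \<Rightarrow> bool" where
  "plus_type sc Q \<longleftrightarrow>
     quadratic_form sc Q \<and> nondegenerate Q \<and>
     2 * witt_index sc Q = vector_space.dim sc (UNIV :: 'v set)"

definition orthogonal_group ::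
  "('a::field \<Rightarrow> 'v::ab_group_add \<Rightarrow> 'v) \<Rightarrow> ('v \<Rightarrow> 'a) \<Rightarrow> ('v \<Rightarrow> 'v) set" where
  "orthogonal_group sc Q =
     {g. Vector_Spaces.linear sc sc g \<and> bij g \<and> (\<forall>v. Q (g v) = Q v)}"

(* These make pmf_of_set (orthogonal_group sc Q) the uniform distribution. *)
lemma finite_orthogonal_group:
  fixes sc :: "'a::field \<Rightarrow> 'v::{ab_group_add,finite} \<Rightarrow> 'v"
  shows "finite (orthogonal_group sc Q)"
  by (rule finite_subset[OF subset_UNIV]) simp

lemma orthogonal_group_nonempty:
  assumes "vector_space sc"
  shows "orthogonal_group sc Q \<noteq> {}"
proof -
  interpret vector_space sc by fact
  have "id \<in> orthogonal_group sc Q"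
    using linear_id by (simp add: orthogonal_group_def)
  then show ?thesis by blast
qed

end

(* Write F g for the set of fixed vectors of g and H W for the pointwise stabilizer in the orthogonal
   group of a subspace W. By induction on j, whenever |W| q^j <= q^n,
     sum over g in H W of |F g|^j = |H W| |W|^j (q + 1) (q^2 + 1) ... (q^j + 1).
   For the step, one factor |F g| is expanded as a sum over the vectors v with g v = v, which replaces
   H W by H (W + <v>). The vectors in W contribute |W| equal terms. By Witt's theorem the orbits of H W
   outside W are separated by Q v and the functional B(v, -) on W, and since |W| < q^n all q |W| such
   data occur. *)

theory Submission imports Defs begin

section \<open>Finite nondegenerate quadratic spaces in any characteristic\<close>

locale finite_quadratic_space = vector_space scale
  for scale :: "'a::{field,finite} \<Rightarrow> 'v::{ab_group_add,finite} \<Rightarrow> 'v" (infixr "\<odot>" 75) +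
  fixes Q :: "'v \<Rightarrow> 'a"
  assumes quadratic: "quadratic_form scale Q"
    and nondeg: "nondegenerate Q"
begin

abbreviation B where "B \<equiv> polar Q"

lemma Q_scale [simp]: "Q (a \<odot> v) = a ^ 2 * Q v"
  using quadratic by (simp add: quadratic_form_def)

lemma Q_zero [simp]: "Q 0 = 0"
  using Q_scale[of 0 0] by simp

lemma Q_add: "Q (u + v) = Q u + Q v + B u v"
  by (simp add: polar_def)

lemma B_sym: "B u v = B v u"
  by (simp add: polar_def add.commute)

lemma B_linear_right: "Vector_Spaces.linear scale (*) (B u)"
  using quadratic by (simp add: quadratic_form_def)

lemma B_add_right [simp]: "B u (v + w) = B u v + B u w"
  and B_scale_right [simp]: "B u (a \<odot> v) = a * B u v"
  using B_linear_right[of u]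
  by (auto simp: Vector_Spaces.linear_def module_hom_def module_hom_axioms_def)

lemma B_add_left [simp]: "B (v + w) u = B v u + B w u"
  and B_scale_left [simp]: "B (a \<odot> v) u = a * B v u"
  by (simp_all add: B_sym[of _ u])

lemma B_zero [simp]: "B u 0 = 0" "B 0 u = 0"
  using B_scale_right[of u 0 0] B_scale_left[of 0 0 u] by simp_all

lemma B_minus [simp]: "B u (- v) = - B u v" "B (- v) u = - B v u"
  using B_scale_right[of u "-1" v] B_scale_left[of "-1" v u] by simp_all

lemma B_diff [simp]: "B u (v - w) = B u v - B u w" "B (v - w) u = B v u - B w u"
  using B_add_right[of u v "- w"] B_add_left[of v "- w" u] by simp_all

lemma B_self: "B v v = 2 * Q v"
proof -
  have "Q (2 \<odot> v) = 4 * Q v" by (simp only: Q_scale) simp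
  moreover have "2 \<odot> v = v + v"
    using scale_left_distrib[of 1 1 v] by simp
  ultimately show ?thesis by (simp add: polar_def)
qed

lemma Q_minus [simp]: "Q (- v) = Q v"
  using Q_scale[of "-1" v] by simp

lemma Q_diff: "Q (u - v) = Q u + Q v - B u v"
  using Q_add[of u "- v"] by simp

section \<open>Duality under the polar form\<close>

lemma perp_span:
  assumes "\<And>s. s \<in> S \<Longrightarrow> B s y = 0" "w \<in> span S"
  shows "B w y = 0"
  using assms(2) by (induction rule: span_induct_alt) (simp_all add: assms(1))

text \<open>Nondegeneracy is the case of empty \<open>S\<close>; the induction removes one element
  of \<open>S\<close> at a time, as in Gaussian elimination.\<close>

lemma separating_vector:
  fixes S :: "'v set"
  assumes "v \<notin> span S"
  shows "\<exists>y. (\<forall>s\<in>S. B s y = 0) \<and> B v y = 1"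
proof -
  have "\<exists>y. (\<forall>s\<in>S. B s y = 0) \<and> B v y \<noteq> 0"
    using finite[of S] assms
  proof (induction S arbitrary: v rule: finite_induct)
    case empty
    then show ?case using nondeg by (auto simp: nondegenerate_def)
  next
    case (insert s S)
    show ?case
    proof (cases "s \<in> span S")
      case True
      then have "v \<notin> span S" using insert.prems by (simp add: span_redundant)
      then obtain y where y: "\<forall>s\<in>S. B s y = 0" "B v y \<noteq> 0"
        using insert.IH by blast
      then have "B s y = 0" using perp_span[of S y s] True by blast
      with y show ?thesis by auto
    next
      case False
      then obtain z where z: "\<forall>s\<in>S. B s z = 0" "B s z \<noteq> 0"
        using insert.IH by blast
      \<comment> \<open>The coefficient makes this vector orthogonal to \<open>z\<close>. Below,
        \<open>?y\<close> is \<open>y\<close> corrected along \<open>z\<close> to be orthogonal to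
        \<open>s\<close>, and \<open>B v ?y\<close> equals the value of \<open>B\<close> at this
        vector and \<open>y\<close>.\<close>
      have "v - (B v z / B s z) \<odot> s \<notin> span S"
        using insert.prems by (auto simp: span_breakdown_eq)
      then obtain y where y: "\<forall>s\<in>S. B s y = 0" "B (v - (B v z / B s z) \<odot> s) y \<noteq> 0"
        using insert.IH by blast
      let ?y = "y - (B s y / B s z) \<odot> z"
      have "\<forall>t\<in>insert s S. B t ?y = 0" using y z by auto
      moreover have "B v ?y \<noteq> 0" using y(2) by (simp add: field_simps)
      ultimately show ?thesis by blast
    qed
  qed
  then obtain y where "\<forall>s\<in>S. B s y = 0" "B v y \<noteq> 0" by blast
  then show ?thesis by (intro exI[of _ "(1 / B v y) \<odot> y"]) auto
qed

text \<open>A separating vector for the new element corrects the value there and leaves the earlier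
  values alone.\<close>

lemma interpolating_vector:
  fixes S :: "'v set"
  assumes "independent S"
  shows "\<exists>v. \<forall>s\<in>S. B s v = f s"
  using finite[of S] assms
proof (induction S rule: finite_induct)
  case empty
  then show ?case by simp
next
  case (insert s S)
  then have ind: "independent S" "s \<notin> span S"
    by (auto simp: independent_insert)
  obtain v where v: "\<forall>t\<in>S. B t v = f t" using insert.IH ind by blast
  obtain y where y: "\<forall>t\<in>S. B t y = 0" "B s y = 1" using separating_vector ind by blast
  show ?case using v y by (intro exI[of _ "v + (f s - B s v) \<odot> y"]) auto
qed

section \<open>Cardinalities of spans\<close>

lemma card_span_insert:
  assumes "subspace W" "v \<notin> W"
  shows "card (span (insert v W)) = CARD('a) * card W"
proof -
  let ?f = "\<lambda>(a, w). a \<odot> v + w"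
  have "inj_on ?f (UNIV \<times> W)"
  proof (rule inj_onI, clarsimp)
    fix a w b w' assume w: "w \<in> W" "w' \<in> W" and eq: "a \<odot> v + w = b \<odot> v + w'"
    have e: "(a - b) \<odot> v = w' - w" using eq by (simp add: scale_left_diff_distrib algebra_simps)
    have "a = b"
    proof (rule ccontr)
      assume "a \<noteq> b"
      then have "v = (1 / (a - b)) \<odot> ((a - b) \<odot> v)" by simp
      then have "v = (1 / (a - b)) \<odot> (w' - w)" by (simp only: e)
      then show False using assms w subspace_scale subspace_diff by metis
    qed
    then show "a = b \<and> w = w'" using eq by simp
  qed
  moreover have "?f ` (UNIV \<times> W) = span (insert v W)"
  proof
    show "?f ` (UNIV \<times> W) \<subseteq> span (insert v W)"
      by (auto intro!: span_add span_scale intro: span_base)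
    show "span (insert v W) \<subseteq> ?f ` (UNIV \<times> W)"
    proof
      fix x assume "x \<in> span (insert v W)"
      then obtain k where "x - k \<odot> v \<in> W"
        using assms by (auto simp: span_breakdown_eq span_eq_iff[THEN iffD2])
      then show "x \<in> ?f ` (UNIV \<times> W)" by (intro image_eqI[of _ _ "(k, x - k \<odot> v)"]) auto
    qed
  qed
  ultimately have "card (span (insert v W)) = card ((UNIV :: 'a set) \<times> W)"
    by (metis card_image)
  then show ?thesis by (simp add: card_cartesian_product)
qed

lemma card_span_independent:
  fixes S :: "'v set"
  assumes "independent S"
  shows "card (span S) = CARD('a) ^ card S"
  using finite[of S] assms
proof (induction S rule: finite_induct)
  case empty
  then show ?case by simp
next
  case (insert s S)
  then have ind: "independent S" "s \<notin> span S"
    by (auto simp: independent_insert)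
  have "span (insert s S) = span (insert s (span S))"
    by (auto simp: span_breakdown_eq span_span)
  then show ?case using card_span_insert[OF subspace_span ind(2)] insert ind by simp
qed

section \<open>Pointwise stabilizers in the orthogonal group\<close>

abbreviation "O_group \<equiv> orthogonal_group scale Q"

definition fixer :: "'v set \<Rightarrow> ('v \<Rightarrow> 'v) set" where
  "fixer W = {g \<in> O_group. \<forall>w\<in>W. g w = w}"

text \<open>Bijectivity comes for free: an additive map preserving \<open>Q\<close> preserves
  \<open>B\<close>, so nondegeneracy makes it injective, and the space is finite.\<close>

lemma O_groupI:
  assumes add: "\<And>x y. g (x + y) = g x + g y" and scale: "\<And>a x. g (a \<odot> x) = a \<odot> g x"
    and Q: "\<And>x. Q (g x) = Q x"
  shows "g \<in> O_group"
proof -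
  have lin: "Vector_Spaces.linear scale scale g"
    using add scale by unfold_locales auto
  have BB: "B (g x) (g y) = B x y" for x y
    unfolding polar_def by (simp only: add[symmetric] Q)
  have "inj g"
  proof (rule injI)
    fix x y assume "g x = g y"
    then have "B (x - y) z = 0" for z
      using BB[of x z] BB[of y z] by simp
    then have "x - y = 0" using nondeg unfolding nondegenerate_def by blast
    then show "x = y" by simp
  qed
  then have "bij g" by (simp add: bij_def finite_UNIV_inj_surj)
  then show ?thesis using lin Q by (simp add: orthogonal_group_def)
qed

lemma O_group_props:
  assumes "g \<in> O_group"
  shows "g (x + y) = g x + g y" "g (a \<odot> x) = a \<odot> g x" "Q (g x) = Q x"
    "B (g x) (g y) = B x y" "bij g"
proof -
  show a: "g (x + y) = g x + g y" for x y
    using assms unfolding orthogonal_group_def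
    by (auto simp: Vector_Spaces.linear_def module_hom_def module_hom_axioms_def)
  show "g (a \<odot> x) = a \<odot> g x"
    using assms unfolding orthogonal_group_def
    by (auto simp: Vector_Spaces.linear_def module_hom_def module_hom_axioms_def)
  show q: "Q (g x) = Q x" for x
    using assms by (simp add: orthogonal_group_def)
  show "bij g"
    using assms by (simp add: orthogonal_group_def)
  show "B (g x) (g y) = B x y"
    unfolding polar_def by (simp only: a[symmetric] q)
qed

lemma fixer_comp:
  assumes "g \<in> fixer W" "h \<in> fixer W"
  shows "g \<circ> h \<in> fixer W"
proof -
  have "g \<in> O_group" "h \<in> O_group" using assms by (auto simp: fixer_def)
  then have "g \<circ> h \<in> O_group"
    by (intro O_groupI) (simp_all add: O_group_props)
  then show ?thesis using assms by (simp add: fixer_def)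
qed

lemma fixer_inv:
  assumes "g \<in> fixer W"
  shows "inv g \<in> fixer W"
proof -
  have g: "g \<in> O_group" "\<And>w. w \<in> W \<Longrightarrow> g w = w" using assms by (auto simp: fixer_def)
  note bij = O_group_props(5)[OF g(1)]
  have gi: "g (inv g x) = x" for x using bij by (simp add: bij_is_surj surj_f_inv_f)
  have ig: "inv g (g x) = x" for x using bij by (simp add: bij_is_inj)
  have "inv g \<in> O_group"
  proof (rule O_groupI)
    show "inv g (x + y) = inv g x + inv g y" for x y
      using O_group_props(1)[OF g(1), of "inv g x" "inv g y"] ig gi by metis
    show "inv g (a \<odot> x) = a \<odot> inv g x" for a x
      using O_group_props(2)[OF g(1), of a "inv g x"] ig gi by metis
    show "Q (inv g x) = Q x" for x
      using O_group_props(3)[OF g(1), of "inv g x"] gi by metis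
  qed
  moreover have "inv g w = w" if "w \<in> W" for w
    using ig[of w] g(2)[OF that] by simp
  ultimately show ?thesis by (simp add: fixer_def)
qed

lemma fixer_span_insert:
  assumes "subspace W"
  shows "fixer (span (insert v W)) = {g \<in> fixer W. g v = v}"
proof -
  have "g x = x" if "g \<in> fixer W" "g v = v" "x \<in> span (insert v W)" for g x
  proof -
    have g: "g \<in> O_group" using that by (simp add: fixer_def)
    have g0: "g 0 = 0" using O_group_props(2)[OF g, of 0 0] by simp
    show ?thesis using that(3)
    proof (induction rule: span_induct_alt)
      case base
      then show ?case by (rule g0)
    next
      case (step c x y)
      then show ?case using that g by (auto simp: O_group_props fixer_def)
    qed
  qed
  then show ?thesis by (auto simp: fixer_def span_base)
qed

section \<open>Explicit isometries and Witt's theorem for one additional vector\<close>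

lemma reflection_in_O_group:
  assumes "Q u \<noteq> 0"
  shows "(\<lambda>x. x - (B x u / Q u) \<odot> u) \<in> O_group"
  using assms
  by (intro O_groupI)
    (auto simp: algebra_simps scale_left_distrib scale_left_diff_distrib
      add_divide_distrib Q_diff power2_eq_square)

text \<open>A Siegel transformation. The vector \<open>y\<close> may be nonsingular; the term with
  \<open>Q y\<close> compensates for this.\<close>

lemma siegel_in_O_group:
  assumes "Q u = 0" "B u y = 0"
  shows "(\<lambda>x. x + B x u \<odot> y - (B x y + Q y * B x u) \<odot> u) \<in> O_group"
  using assms
  by (intro O_groupI)
    (auto simp: algebra_simps scale_left_distrib Q_diff Q_add power2_eq_square B_sym[of y u] B_self)

text \<open>The map sends \<open>u\<close> to \<open>c\<close> times \<open>u\<close> and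
  \<open>z\<close> to \<open>1 / c\<close> times \<open>z\<close>, and fixes every vector orthogonal
  to both.\<close>

lemma hyperbolic_scaling_in_O_group:
  assumes "Q u = 0" "Q z = 0" "B u z = 1" "c \<noteq> 0"
  shows "(\<lambda>x. x + ((c - 1) * B x z) \<odot> u + ((1 / c - 1) * B x u) \<odot> z) \<in> O_group"
  using assms
  by (intro O_groupI)
    (auto simp: algebra_simps scale_left_distrib scale_left_diff_distrib Q_diff Q_add power2_eq_square B_sym[of z u] B_self)

text \<open>With \<open>u = v' - v\<close>, the isometry is the reflection in \<open>u\<close> if \<open>u\<close> is nonsingular. Otherwise \<open>u\<close> is
  orthogonal to \<open>v\<close> and \<open>W\<close>; a Siegel transformation along \<open>u\<close> works unless \<open>v\<close> lies in \<open>W + \<langle>u\<rangle>\<close>, and then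
  one rescales \<open>u\<close> inside a hyperbolic pair orthogonal to \<open>W\<close>. No step divides by 2.\<close>

lemma witt_step:
  assumes W: "subspace W" and v: "v \<notin> W" "v' \<notin> W"
    and Q: "Q v' = Q v" and BW: "\<And>w. w \<in> W \<Longrightarrow> B w v' = B w v"
  shows "\<exists>g\<in>fixer W. g v = v'"
proof -
  define u where "u = v' - v"
  have v': "v' = v + u" by (simp add: u_def)
  have uW: "B w u = 0" if "w \<in> W" for w using BW[OF that] by (simp add: u_def)
  have uv: "B v u = - Q u" using Q unfolding v' Q_add by (simp add: eq_neg_iff_add_eq_0 algebra_simps)
  have spanW: "span W = W" using W by (simp add: span_eq_iff)
  show ?thesis
  proof (cases "Q u = 0")
    case False
    let ?g = "\<lambda>x. x - (B x u / Q u) \<odot> u"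
    have "?g \<in> fixer W" using reflection_in_O_group[OF False] uW by (simp add: fixer_def)
    moreover have "?g v = v'" using False by (simp add: uv v')
    ultimately show ?thesis by (intro bexI[of _ ?g])
  next
    case Qu: True
    show ?thesis
    proof (cases "v \<in> span (insert u W)")
      case False
      then obtain y where y: "\<forall>s\<in>insert u W. B s y = 0" "B v y = 1"
        using separating_vector by blast
      \<comment> \<open>Here \<open>B v u = 0\<close> and \<open>B v (- y) = -1\<close>, so the sign
        of \<open>- y\<close> makes \<open>v\<close> go to \<open>v + u\<close>.\<close>
      let ?g = "\<lambda>x. x + B x u \<odot> (- y) - (B x (- y) + Q (- y) * B x u) \<odot> u"
      have "?g \<in> fixer W" using siegel_in_O_group[of u "- y"] Qu y uW by (simp add: fixer_def)
      moreover have "?g v = v'" using y Qu by (simp add: uv v')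
      ultimately show ?thesis by (intro bexI[of _ ?g])
    next
      case True
      then obtain b where b: "v - b \<odot> u \<in> W" by (auto simp: span_breakdown_eq spanW)
      define w where "w = v - b \<odot> u"
      have w: "w \<in> W" "v = w + b \<odot> u" using b by (simp_all add: w_def)
      have "b \<noteq> 0" using w v by auto
      have "v' = w + (b + 1) \<odot> u" using w(2) v' by (simp add: scale_left_distrib)
      then have "b + 1 \<noteq> 0" using w v by auto
      have "u \<notin> W" using w v W by (metis subspace_add subspace_scale)
      then obtain z0 where z0: "\<forall>s\<in>W. B s z0 = 0" "B u z0 = 1"
        using separating_vector spanW by metis
      \<comment> \<open>This makes \<open>z\<close> singular and keeps \<open>B u z = 1\<close>,
        since \<open>u\<close> is orthogonal to itself.\<close>
      define z where "z = z0 - Q z0 \<odot> u"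
      have uu: "B u u = 0" using Qu by (simp add: B_self)
      have z: "\<forall>s\<in>W. B s z = 0" "B u z = 1" "Q z = 0"
        using z0 uW Qu uu B_sym[of z0 u] by (auto simp: z_def Q_diff)
      \<comment> \<open>Since \<open>v\<close> is \<open>w\<close> plus \<open>b\<close> times
        \<open>u\<close> and \<open>v'\<close> is \<open>w\<close> plus \<open>b + 1\<close> times
        \<open>u\<close>, scaling \<open>u\<close> by this factor while fixing \<open>w\<close>
        carries \<open>v\<close> to \<open>v'\<close>.\<close>
      define c where "c = (b + 1) / b"
      have "c \<noteq> 0" using \<open>b \<noteq> 0\<close> \<open>b + 1 \<noteq> 0\<close> by (simp add: c_def)
      let ?g = "\<lambda>x. x + ((c - 1) * B x z) \<odot> u + ((1 / c - 1) * B x u) \<odot> z"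
      have "?g \<in> fixer W"
        using hyperbolic_scaling_in_O_group[OF Qu z(3) z(2) \<open>c \<noteq> 0\<close>] z uW by (simp add: fixer_def)
      moreover have "?g v = v'"
      proof -
        have "B v z = b" using w z by simp
        moreover have "(c - 1) * b = 1" using \<open>b \<noteq> 0\<close> by (simp add: c_def field_simps)
        ultimately show ?thesis using uv Qu v' by simp
      qed
      ultimately show ?thesis by (intro bexI[of _ ?g])
    qed
  qed
qed

section \<open>Orbit-stabilizer counting\<close>

lemma sum_card_stabilizers_orbit:
  assumes v0: "v0 \<in> X"
    and trans: "\<And>v. v \<in> X \<Longrightarrow> \<exists>g\<in>fixer W. g v0 = v"
    and inv: "\<And>g. g \<in> fixer W \<Longrightarrow> g v0 \<in> X"
  shows "(\<Sum>v\<in>X. card {g \<in> fixer W. g v = v}) = card (fixer W)"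
proof -
  have eq: "card {g \<in> fixer W. g v = v} = card {g \<in> fixer W. g v0 = v}" if "v \<in> X" for v
  proof -
    obtain h where h: "h \<in> fixer W" "h v0 = v" using trans[OF \<open>v \<in> X\<close>] by blast
    have bij: "bij h" using h O_group_props(5) by (auto simp: fixer_def)
    have gi: "h (inv h x) = x" for x using bij by (simp add: bij_is_surj surj_f_inv_f)
    have ig: "inv h (h x) = x" for x using bij by (simp add: bij_is_inj)
    \<comment> \<open>Composing with \<open>h\<close> on the right turns the stabilizer of
      \<open>v\<close> into the coset of elements carrying \<open>v0\<close> to \<open>v\<close>. As
      \<open>v\<close> runs over the orbit, these cosets partition \<open>fixer W\<close>.\<close>
    have "bij_betw (\<lambda>g. g \<circ> h) {g \<in> fixer W. g v = v} {g \<in> fixer W. g v0 = v}"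
    proof (rule bij_betw_byWitness[where f' = "\<lambda>g. g \<circ> inv h"])
      show "(\<lambda>g. g \<circ> h) ` {g \<in> fixer W. g v = v} \<subseteq> {g \<in> fixer W. g v0 = v}"
        using h by (auto intro: fixer_comp)
      show "(\<lambda>g. g \<circ> inv h) ` {g \<in> fixer W. g v0 = v} \<subseteq> {g \<in> fixer W. g v = v}"
        using h fixer_inv[OF h(1)] ig by (auto intro: fixer_comp)
    qed (auto simp: fun_eq_iff gi ig)
    then show ?thesis by (rule bij_betw_same_card)
  qed
  have "(\<Sum>v\<in>X. card {g \<in> fixer W. g v = v}) = (\<Sum>v\<in>X. card {g \<in> fixer W. g v0 = v})"
    using eq by (intro sum.cong) auto
  also have "\<dots> = card (\<Union>v\<in>X. {g \<in> fixer W. g v0 = v})"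
    by (subst card_UN_disjoint) auto
  also have "(\<Union>v\<in>X. {g \<in> fixer W. g v0 = v}) = fixer W" using inv by auto
  finally show ?thesis .
qed

section \<open>Totally singular subspaces and vectors with prescribed invariants\<close>

lemma totally_singular_orthogonal:
  assumes "totally_singular scale Q U" "x \<in> U" "y \<in> U"
  shows "B x y = 0"
  using assms subspace_add[of U x y] by (simp add: totally_singular_def polar_def)

text \<open>Only a complement of \<open>W \<inter> U\<close> in \<open>W\<close> imposes conditions on \<open>U\<close>, because \<open>U\<close> is orthogonal to
  itself. If the solutions in \<open>U\<close> were all in \<open>W \<inter> U\<close>, then \<open>U\<close> would have at most
  \<open>|W / (W \<inter> U)| |W \<inter> U| = |W|\<close> elements.\<close>

lemma exists_singular_perp:
  assumes U: "totally_singular scale Q U" and W: "subspace W" and less: "card W < card U"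
  shows "\<exists>y\<in>U. y \<notin> W \<and> (\<forall>w\<in>W. B w y = 0)"
proof (rule ccontr)
  assume none: "\<not> ?thesis"
  have subU: "subspace U" using U by (simp add: totally_singular_def)
  have subI: "subspace (W \<inter> U)" using W subU by (rule subspace_inter)
  obtain S0 where S0: "S0 \<subseteq> W \<inter> U" "independent S0" "W \<inter> U \<subseteq> span S0"
    using maximal_independent_subset[of "W \<inter> U"] by blast
  obtain S where S: "S0 \<subseteq> S" "S \<subseteq> W" "independent S" "W \<subseteq> span S"
    using maximal_independent_subset_extend[of S0 W] S0 by auto
  have spanS: "span S = W" using S W span_minimal by blast
  have spanS0: "span S0 = W \<inter> U" using S0 subI span_minimal by blast
  let ?T = "S - S0"
  define \<phi> where "\<phi> u = restrict (\<lambda>s. B s u) ?T" for u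
  define K where "K = {u \<in> U. \<forall>w\<in>W. B w u = 0}"
  have K: "K \<subseteq> W \<inter> U" using none by (auto simp: K_def)
  \<comment> \<open>The difference of two elements of a fibre is orthogonal to \<open>?T\<close> by
    the choice of \<phi>, and to \<open>S0\<close> because both lie in \<open>U\<close>.\<close>
  have fibre: "card {u \<in> U. \<phi> u = p} \<le> card K" if p: "p \<in> \<phi> ` U" for p
  proof -
    obtain u0 where u0: "u0 \<in> U" "p = \<phi> u0" using p by blast
    have "u - u0 \<in> K" if u: "u \<in> U" "\<phi> u = p" for u
    proof -
      have d: "u - u0 \<in> U" using u u0 subU by (simp add: subspace_diff)
      have "B s (u - u0) = 0" if "s \<in> S" for s
      proof (cases "s \<in> S0")
        case True
        then show ?thesis using S0 totally_singular_orthogonal[OF U _ d] by blast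
      next
        case False
        then have "\<phi> u s = \<phi> u0 s" using u u0 by simp
        then show ?thesis using False that by (simp add: \<phi>_def)
      qed
      then show ?thesis using d perp_span[of S "u - u0"] spanS by (auto simp: K_def)
    qed
    then have "(\<lambda>u. u - u0) ` {u \<in> U. \<phi> u = p} \<subseteq> K" by auto
    then show ?thesis by (rule card_inj_on_le[rotated]) (auto simp: inj_on_def)
  qed
  have cS0: "card (W \<inter> U) = CARD('a) ^ card S0" using card_span_independent[OF S0(2)] spanS0 by simp
  have cS: "card W = CARD('a) ^ card S" using card_span_independent[OF S(3)] spanS by simp
  have "\<phi> ` U \<subseteq> ?T \<rightarrow>\<^sub>E UNIV" by (auto simp: \<phi>_def PiE_def extensional_def)
  then have "card (\<phi> ` U) \<le> card (?T \<rightarrow>\<^sub>E (UNIV :: 'a set))" by (intro card_mono finite_PiE) auto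
  then have im: "card (\<phi> ` U) \<le> CARD('a) ^ card ?T" by (simp add: card_PiE)
  have "card U = card (\<Union>p\<in>\<phi> ` U. {u \<in> U. \<phi> u = p})" by (rule arg_cong[of _ _ card]) auto
  also have "\<dots> = (\<Sum>p\<in>\<phi> ` U. card {u \<in> U. \<phi> u = p})"
    by (rule card_UN_disjoint) auto
  also have "\<dots> \<le> (\<Sum>p\<in>\<phi> ` U. card K)" by (intro sum_mono fibre)
  also have "\<dots> = card (\<phi> ` U) * card K" by simp
  also have "\<dots> \<le> CARD('a) ^ card ?T * card (W \<inter> U)"
    by (intro mult_mono im card_mono K) auto
  also have "\<dots> = CARD('a) ^ (card ?T + card S0)" by (simp add: cS0 power_add)
  also have "card ?T + card S0 = card S" using S(1) by (simp add: card_Diff_subset card_mono)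
  finally show False using less cS by simp
qed

text \<open>Take a singular \<open>y\<close> outside \<open>span S\<close> and orthogonal to it, and
  interpolate with the extra value 1 at \<open>y\<close>. Adding a multiple of \<open>y\<close> then
  shifts \<open>Q\<close> by exactly that scalar without changing the values on \<open>S\<close>.
  Pairing to 1 with \<open>y\<close> keeps the vector outside \<open>span S\<close>.\<close>

lemma exists_with_invariants:
  assumes U: "totally_singular scale Q U" and S: "independent S" and less: "card (span S) < card U"
  shows "\<exists>v. v \<notin> span S \<and> Q v = c \<and> (\<forall>s\<in>S. B s v = f s)"
proof -
  obtain y where y: "y \<in> U" "y \<notin> span S" "\<forall>w\<in>span S. B w y = 0"
    using exists_singular_perp[OF U subspace_span less] by blast
  have Qy: "Q y = 0" using U y by (simp add: totally_singular_def)
  have "independent (insert y S)" using S y by (simp add: independent_insertI)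
  then obtain v0 where "\<forall>s\<in>insert y S. B s v0 = (f(y := 1)) s"
    using interpolating_vector[of "insert y S" "f(y := 1)"] by blast
  then have v0: "B y v0 = 1" "\<forall>s\<in>S. B s v0 = f s"
    using y(2) span_base[of _ S] by (auto split: if_splits)
  define v where "v = v0 + (c - Q v0) \<odot> y"
  have "B v y = 1" using v0 Qy by (simp add: v_def B_self B_sym[of v0 y])
  then have "v \<notin> span S" using y by auto
  moreover have "Q v = c" using v0 Qy by (simp add: v_def Q_add B_sym[of v0 y])
  moreover have "\<forall>s\<in>S. B s v = f s" using v0 y span_base[of _ S] by (simp add: v_def)
  ultimately show ?thesis by blast
qed

text \<open>With a basis \<open>S\<close> of \<open>W\<close>, the functional on \<open>W\<close> is
  recorded by its values on \<open>S\<close>. Each of the \<open>CARD('a) * card W\<close> possible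
  data is one orbit of \<open>fixer W\<close> outside \<open>W\<close>, and each orbit contributes
  \<open>card (fixer W)\<close>.\<close>

lemma sum_card_stabilizers_outside:
  assumes U: "totally_singular scale Q U" and W: "subspace W" and less: "card W < card U"
  shows "(\<Sum>v\<in>- W. card {g \<in> fixer W. g v = v}) = CARD('a) * card W * card (fixer W)"
proof -
  obtain S where S: "S \<subseteq> W" "independent S" "W \<subseteq> span S"
    using maximal_independent_subset[of W] by blast
  have spanS: "span S = W" using S W span_minimal by blast
  define I where "I v = (Q v, restrict (\<lambda>s. B s v) S)" for v
  let ?P = "(UNIV :: 'a set) \<times> (S \<rightarrow>\<^sub>E (UNIV :: 'a set))"
  have B_W: "B w v' = B w v" if I: "I v' = I v" and w: "w \<in> W" for v v' w
  proof -
    have "B s (v' - v) = 0" if "s \<in> S" for s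
    proof -
      have "restrict (\<lambda>s. B s v') S s = restrict (\<lambda>s. B s v) S s" using I by (simp add: I_def)
      then show ?thesis using that by simp
    qed
    then have "B w (v' - v) = 0" using perp_span w spanS by blast
    then show ?thesis by simp
  qed
  have fibre: "(\<Sum>v\<in>{v \<in> - W. I v = p}. card {g \<in> fixer W. g v = v}) = card (fixer W)"
    if p: "p \<in> ?P" for p
  proof -
    obtain c f where cf: "p = (c, f)" "f \<in> S \<rightarrow>\<^sub>E UNIV" using p by auto
    obtain v0 where v0: "v0 \<notin> span S" "Q v0 = c" "\<forall>s\<in>S. B s v0 = f s"
      using exists_with_invariants[OF U S(2), of c f] less spanS by auto
    \<comment> \<open>Off \<open>S\<close> both sides are \<open>undefined\<close>, because
      \<open>f\<close> is extensional.\<close>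
    have "restrict (\<lambda>s. B s v0) S = f"
      by (rule ext) (use v0(3) PiE_arb[OF cf(2)] in \<open>simp add: restrict_def\<close>)
    then have "I v0 = p" using v0(2) cf(1) by (simp add: I_def)
    show ?thesis
    proof (rule sum_card_stabilizers_orbit[of v0])
      show "v0 \<in> {v \<in> - W. I v = p}" using v0 \<open>I v0 = p\<close> spanS by simp
      show "\<exists>g\<in>fixer W. g v0 = v" if v: "v \<in> {v \<in> - W. I v = p}" for v
      proof (rule witt_step[OF W])
        show "v0 \<notin> W" "v \<notin> W" using v0 v spanS by auto
        have eq: "I v = I v0" using v \<open>I v0 = p\<close> by simp
        then show "Q v = Q v0" by (simp add: I_def)
        show "\<And>w. w \<in> W \<Longrightarrow> B w v = B w v0" by (rule B_W[OF eq])
      qed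
      show "g v0 \<in> {v \<in> - W. I v = p}" if g: "g \<in> fixer W" for g
      proof -
        have gO: "g \<in> O_group" and fx: "\<And>w. w \<in> W \<Longrightarrow> g w = w" using g by (auto simp: fixer_def)
        have "B s (g v0) = B s v0" if "s \<in> S" for s
          using O_group_props(4)[OF gO, of s v0] fx[of s] S that by auto
        then have "I (g v0) = I v0"
          using O_group_props(3)[OF gO] by (auto simp: I_def)
        \<comment> \<open>Otherwise \<open>g\<close> fixes \<open>g v0\<close>, and injectivity puts
          \<open>v0\<close> itself in \<open>W\<close>.\<close>
        moreover have "g v0 \<notin> W"
        proof
          assume "g v0 \<in> W"
          then have "g (g v0) = g v0" by (rule fx)
          then have "g v0 = v0" using O_group_props(5)[OF gO] by (simp add: bij_is_inj inj_eq)
          then show False using \<open>g v0 \<in> W\<close> v0 spanS by simp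
        qed
        ultimately show ?thesis using \<open>I v0 = p\<close> by simp
      qed
    qed
  qed
  have "- W = (\<Union>p\<in>?P. {v \<in> - W. I v = p})" by (auto simp: I_def PiE_def extensional_def)
  then have "(\<Sum>v\<in>- W. card {g \<in> fixer W. g v = v})
      = (\<Sum>v\<in>(\<Union>p\<in>?P. {v \<in> - W. I v = p}). card {g \<in> fixer W. g v = v})"
    by (rule sum.cong) (rule refl)
  also have "\<dots> = (\<Sum>p\<in>?P. \<Sum>v\<in>{v \<in> - W. I v = p}. card {g \<in> fixer W. g v = v})"
    by (rule sum.UNION_disjoint) (auto intro!: finite_cartesian_product finite_PiE)
  also have "\<dots> = card ?P * card (fixer W)"
    using fibre by simp
  also have "card ?P = CARD('a) * card W"
    using card_span_independent[OF S(2)] spanS by (simp add: card_cartesian_product card_PiE)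
  finally show ?thesis .
qed

section \<open>Moments of the number of fixed vectors\<close>

lemma sum_fixed_vectors_power:
  assumes U: "totally_singular scale Q U" and W: "subspace W"
    and le: "card W * CARD('a) ^ j \<le> card U"
  shows "(\<Sum>g\<in>fixer W. card {v. g v = v} ^ j)
    = card (fixer W) * card W ^ j * (\<Prod>i=1..j. CARD('a) ^ i + 1)"
  using W le
proof (induction j arbitrary: W)
  case 0
  then show ?case by simp
next
  case (Suc j)
  let ?q = "CARD('a)"
  let ?\<Pi> = "\<Prod>i=1..j. ?q ^ i + 1"
  let ?H = "\<lambda>v. {g \<in> fixer W. g v = v}"
  have "card {0, 1 :: 'a} \<le> ?q" by (rule card_mono) auto
  then have q: "?q \<ge> 2" by simp
  have W0: "card W > 0" using subspace_0[OF Suc.prems(1)] by (auto simp: card_gt_0_iff)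
  have Wj: "card W * ?q ^ j < card U" 
  proof -
    have "card W * ?q ^ j < card W * ?q ^ Suc j" using W0 q by simp
    then show ?thesis using Suc.prems(2) by linarith
  qed
  have WU: "card W < card U"
  proof -
    have "card W * 1 \<le> card W * ?q ^ j" by (intro mult_left_mono) (use q in auto)
    then show ?thesis using Wj by linarith
  qed
  have inner: "(\<Sum>g\<in>?H v. card {v. g v = v} ^ j)
      = card (?H v) * card (span (insert v W)) ^ j * ?\<Pi>" for v
  proof -
    \<comment> \<open>The size bound survives the step: a vector outside \<open>W\<close> multiplies
      the size of the subspace by \<open>?q\<close> while the exponent drops by one.\<close>
    have "card (span (insert v W)) * ?q ^ j \<le> card U"
    proof (cases "v \<in> W")
      case True
      then have "span (insert v W) = W" using Suc.prems(1) by (simp add: insert_absorb span_eq_iff)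
      then show ?thesis using Wj by simp
    next
      case False
      then show ?thesis using card_span_insert[OF Suc.prems(1) False] Suc.prems(2)
        by (simp add: mult_ac)
    qed
    from Suc.IH[OF subspace_span this] show ?thesis
      by (simp only: fixer_span_insert[OF Suc.prems(1)])
  qed
  have "(\<Sum>g\<in>fixer W. card {v. g v = v} ^ Suc j)
      = (\<Sum>g\<in>fixer W. \<Sum>v | v \<in> UNIV \<and> g v = v. card {v. g v = v} ^ j)" by simp
  also have "\<dots> = (\<Sum>v\<in>UNIV. \<Sum>g\<in>?H v. card {v. g v = v} ^ j)"
    by (rule sum.swap_restrict) auto
  also have "\<dots> = (\<Sum>v\<in>UNIV. card (?H v) * card (span (insert v W)) ^ j * ?\<Pi>)"
    using inner by simp
  also have "\<dots> = (\<Sum>v\<in>W. card (?H v) * card (span (insert v W)) ^ j * ?\<Pi>)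
      + (\<Sum>v\<in>- W. card (?H v) * card (span (insert v W)) ^ j * ?\<Pi>)"
    by (subst sum.union_disjoint[symmetric]) (auto simp: Compl_partition)
  also have "(\<Sum>v\<in>W. card (?H v) * card (span (insert v W)) ^ j * ?\<Pi>)
      = (\<Sum>v\<in>W. card (fixer W) * card W ^ j * ?\<Pi>)"
  proof (rule sum.cong[OF refl])
    fix v assume v: "v \<in> W"
    then have "?H v = fixer W" by (auto simp: fixer_def)
    moreover have "span (insert v W) = W"
      using v Suc.prems(1) by (simp add: insert_absorb span_eq_iff)
    ultimately show "card (?H v) * card (span (insert v W)) ^ j * ?\<Pi>
      = card (fixer W) * card W ^ j * ?\<Pi>" by simp
  qed
  also have "(\<Sum>v\<in>- W. card (?H v) * card (span (insert v W)) ^ j * ?\<Pi>)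
      = (\<Sum>v\<in>- W. card (?H v)) * (?q * card W) ^ j * ?\<Pi>"
    unfolding sum_distrib_right
    by (rule sum.cong[OF refl]) (simp add: card_span_insert[OF Suc.prems(1)])
  also have "(\<Sum>v\<in>- W. card (?H v)) = ?q * card W * card (fixer W)"
    by (rule sum_card_stabilizers_outside[OF U Suc.prems(1) WU])
  \<comment> \<open>With common factor \<open>card (fixer W) * card W ^ Suc j * ?\<Pi>\<close>, the
    vectors in \<open>W\<close> contribute 1 and those outside contribute \<open>?q ^ Suc j\<close>;
    this is the new factor of the product.\<close>
  finally show ?case by (simp add: algebra_simps power_mult_distrib)
qed

end

theorem theorem4p7:
  fixes sc :: "'a::{field,finite} \<Rightarrow> 'v::{ab_group_add,finite} \<Rightarrow> 'v"
    and Q :: "'v \<Rightarrow> 'a"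
    and q n j :: nat
  assumes "q = CARD('a)"
    and "vector_space sc"
    and "vector_space.dim sc (UNIV :: 'v set) = 2 * n"
    and "plus_type sc Q"
    and "j \<le> n"
  shows "measure_pmf.expectation (pmf_of_set (orthogonal_group sc Q))
           (\<lambda>g. real (card {v. g v = v}) ^ j)
         = (\<Prod>i = 1..j. (real q ^ i + 1))"
proof -
  interpret vector_space sc by fact
  interpret finite_quadratic_space sc Q
    using assms(4) by unfold_locales (auto simp: plus_type_def)
  let ?D = "{dim W | W. totally_singular sc Q W}"
  have "?D = dim ` {W. totally_singular sc Q W}" by auto
  then have fin: "finite ?D" by simp
  have "totally_singular sc Q {0}" by (simp add: totally_singular_def)
  then have "?D \<noteq> {}" by blast
  with fin have "Max ?D \<in> ?D" by (rule Max_in)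
  moreover have "Max ?D = n" using assms(3,4) by (simp add: plus_type_def witt_index_def)
  \<comment> \<open>Plus type enters here: the maximal Witt index provides a totally singular
    \<open>U\<close> with \<open>CARD('a) ^ n\<close> elements.\<close>
  ultimately obtain U where U: "totally_singular sc Q U" "dim U = n" by auto
  obtain S where S: "S \<subseteq> U" "independent S" "U \<subseteq> span S" "card S = dim U"
    using basis_exists[of U] by blast
  have "span S = U" using span_minimal[OF S(1)] S(3) U(1) by (auto simp: totally_singular_def)
  then have cU: "card U = CARD('a) ^ n" using card_span_independent[OF S(2)] S(4) U(2) by simp
  have "fixer {0} = O_group"
    using O_group_props(2)[of _ 0 0] by (auto simp: fixer_def)
  \<comment> \<open>For the zero subspace the size bound is exactly
    \<open>j \<le> n\<close>.\<close>
  moreover have "card {0 :: 'v} * CARD('a) ^ j \<le> card U"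
    using assms(5) by (simp add: cU power_increasing)
  ultimately have main: "(\<Sum>g\<in>O_group. card {v. g v = v} ^ j)
      = card O_group * (\<Prod>i=1..j. q ^ i + 1)"
    using sum_fixed_vectors_power[OF U(1) subspace_single_0, of j] assms(1) by simp
  have ne: "O_group \<noteq> {}" by (rule orthogonal_group_nonempty) fact
  have "measure_pmf.expectation (pmf_of_set O_group) (\<lambda>g. real (card {v. g v = v}) ^ j)
      = real (\<Sum>g\<in>O_group. card {v. g v = v} ^ j) / real (card O_group)"
    by (subst integral_pmf_of_set[OF ne finite_orthogonal_group]) simp
  also have "\<dots> = (\<Prod>i = 1..j. (real q ^ i + 1))"
    using ne finite_orthogonal_group[of sc Q] unfolding main by (simp add: card_gt_0_iff of_nat_prod add_ac)
  finally show ?thesis .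
qed

end
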